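(* Let $A\in\mathbb{R}^{m\times n}$, $\bm{b}\in\mathbb{R}^m$ and $\sigma\ge0$ be such that $\{\bm{x}\in\mathbb{R}^n:\|A\bm{x}-\bm{b}\|_1\le\sigma\}\ne\emptyset$ and $\|\bm{b}\|_1>\sigma$. For any $0<p<1$, the optimal solution set ${\rm SOL}(A,\bm{b},\sigma,p,1)$ is a finite set. Moreover, the set $\bigcup_{0<p<1}{\rm SOL}(A,\bm{b},\sigma,p,1)$ is a finite set.
   Context: For $0<p<1$, $\|\bm{x}\|_p^p:=\sum_{i=1}^n|x_i|^p$, and ${\rm SOL}(A,\bm{b},\sigma,p,1)$ denotes the set of (global) optimal solutions of $$\min_{\bm{x}\in\mathbb{R}^n}\ \|\bm{x}\|_p^p\quad\text{s.t.}\quad\|A\bm{x}-\bm{b}\|_1\le\sigma .$$ *)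

theory Defs
  imports "HOL-Analysis.Analysis"
begin

definition l1_norm :: "real ^ 'k \<Rightarrow> real" where
  "l1_norm x = (\<Sum>i\<in>UNIV. \<bar>x $ i\<bar>)"

text \<open>The \<open>p\<close>-th power of the \<open>p\<close>-quasinorm, used only for \<open>0 < p < 1\<close>. Since \<open>0 powr p = 0\<close>,
  zero entries contribute nothing.\<close>

definition lp_pow :: "real \<Rightarrow> real ^ 'k \<Rightarrow> real" where
  "lp_pow p x = (\<Sum>i\<in>UNIV. \<bar>x $ i\<bar> powr p)"

definition feasible_set :: "real ^ 'n ^ 'm \<Rightarrow> real ^ 'm \<Rightarrow> real \<Rightarrow> (real ^ 'n) set" where
  "feasible_set A b \<sigma> = {x. l1_norm (A *v x - b) \<le> \<sigma>}"

text \<open>The set of global minimizers, written SOL(A, b, sigma, p, 1) in the source; the last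
  argument 1 there refers to the norm in the constraint.\<close>

definition SOL1 :: "real ^ 'n ^ 'm \<Rightarrow> real ^ 'm \<Rightarrow> real \<Rightarrow> real \<Rightarrow> (real ^ 'n) set" where
  "SOL1 A b \<sigma> p =
    {x \<in> feasible_set A b \<sigma>. \<forall>y \<in> feasible_set A b \<sigma>. lp_pow p x \<le> lp_pow p y}"

end

theory Submission
  imports Defs
begin

text \<open>Attach to a point \<open>x\<close> the signs of its entries, the signs of the entries of \<open>A x - b\<close>, and
  whether the constraint is active at \<open>x\<close>. There are finitely many such patterns, and two distinct
  minimizers \<open>x\<close>, \<open>y\<close> (possibly for different exponents) never share one: if they did, the constraint
  function would be affine along the line through \<open>x\<close> and \<open>y\<close> near \<open>x\<close>, so that both
  \<open>x \<plusminus> e (y - x)\<close> would be feasible for small \<open>e\<close>, whereas strict concavity of \<open>t \<mapsto> t\<^sup>p\<close> on the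
  positive axis makes the objective smaller at one of them than at \<open>x\<close>.\<close>

definition sgn_pattern :: "real ^ 'k \<Rightarrow> 'k \<Rightarrow> real" where
  "sgn_pattern x = (\<lambda>i. sgn (x $ i))"

lemma finite_range_sgn_pattern: "finite (range (sgn_pattern :: real ^ 'k \<Rightarrow> _))"
proof (rule finite_subset)
  show "range (sgn_pattern :: real ^ 'k \<Rightarrow> _) \<subseteq> PiE UNIV (\<lambda>_. {-1, 0, 1})"
    by (auto simp: sgn_pattern_def sgn_if split: if_splits)
qed (simp add: finite_PiE)

text \<open>The non-strict bound, applied to \<open>sqrt u\<close> and squared, gains the term
  \<open>p (1 - p) (sqrt u - 1)\<^sup>2\<close>.\<close>

lemma powr_less_tangent_at_1:
  fixes p u :: real
  assumes "0 < p" "p < 1" "0 < u" "u \<noteq> 1"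
  shows "u powr p < 1 + p * (u - 1)"
proof -
  define v where "v = sqrt u"
  have v: "v > 0" "v \<noteq> 1" "u = v\<^sup>2"
    using assms by (auto simp: v_def)
  have "v powr p \<le> p * v + (1 - p)"
    using Youngs_inequality_0[of p "1 - p" v 1] assms v by simp
  then have "(v powr p)\<^sup>2 \<le> (p * v + (1 - p))\<^sup>2"
    by (simp add: power_mono)
  moreover have "(v powr p)\<^sup>2 = u powr p"
    using v by (simp add: power2_eq_square powr_mult)
  moreover have "1 + p * (u - 1) - (p * v + (1 - p))\<^sup>2 = p * (1 - p) * (v - 1)\<^sup>2"
    unfolding v(3) by (simp add: power2_eq_square algebra_simps)
  moreover have "p * (1 - p) * (v - 1)\<^sup>2 > 0"
    using assms v by simp
  ultimately show ?thesis by linarith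
qed

text \<open>Dividing by \<open>\<bar>a\<bar>\<close> moves the base point to 1, and there the linear
  terms of the tangent bounds at \<open>1 + u\<close> and \<open>1 - u\<close> cancel. The bound on
  \<open>\<bar>h\<bar>\<close> keeps \<open>a + h\<close> and \<open>a - h\<close> on the same side
  of 0 as \<open>a\<close>.\<close>

lemma abs_powr_midpoint_strict:
  fixes p a h :: real
  assumes "0 < p" "p < 1" "h \<noteq> 0" "\<bar>h\<bar> < \<bar>a\<bar>"
  shows "\<bar>a + h\<bar> powr p + \<bar>a - h\<bar> powr p < 2 * \<bar>a\<bar> powr p"
proof -
  have a: "\<bar>a\<bar> > 0" using assms by linarith
  define u where "u = h / a"
  have u: "u \<noteq> 0" "\<bar>u\<bar> < 1" "h = a * u"
    using assms a by (auto simp: u_def)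
  have "\<bar>a + h\<bar> = \<bar>a\<bar> * (1 + u)" "\<bar>a - h\<bar> = \<bar>a\<bar> * (1 - u)"
    using u abs_mult[of a "1 + u"] abs_mult[of a "1 - u"] by (auto simp: algebra_simps abs_if)
  moreover have "1 + u \<ge> 0" "1 - u \<ge> 0"
    using u(2) by auto
  ultimately have eq: "\<bar>a + h\<bar> powr p + \<bar>a - h\<bar> powr p = \<bar>a\<bar> powr p * ((1 + u) powr p + (1 - u) powr p)"
    by (simp only: powr_mult abs_ge_zero distrib_left[of "\<bar>a\<bar> powr p"])
  have "(1 + u) powr p < 1 + p * u" "(1 - u) powr p < 1 - p * u"
    using powr_less_tangent_at_1[of p "1 + u"] powr_less_tangent_at_1[of p "1 - u"] assms u by auto
  then have "(1 + u) powr p + (1 - u) powr p < 2" by linarith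
  then show ?thesis
    unfolding eq using a by (simp add: mult.commute)
qed

text \<open>Entries with \<open>h $ i = 0\<close> give equality, and some entry with
  \<open>h $ k \<noteq> 0\<close> gives strictness. Smallness is asked only where \<open>h\<close>
  moves, so \<open>x\<close> may have zero entries as long as \<open>h\<close> vanishes
  there.\<close>

lemma lp_pow_midpoint_strict:
  fixes x h :: "real ^ 'k"
  assumes "0 < p" "p < 1" "h \<noteq> 0"
    and small: "\<And>i. h $ i \<noteq> 0 \<Longrightarrow> \<bar>h $ i\<bar> < \<bar>x $ i\<bar>"
  shows "lp_pow p (x + h) + lp_pow p (x - h) < 2 * lp_pow p x"
proof -
  obtain k where k: "h $ k \<noteq> 0"
    using \<open>h \<noteq> 0\<close> by (auto simp: vec_eq_iff)
  have strict: "\<bar>x $ i + h $ i\<bar> powr p + \<bar>x $ i - h $ i\<bar> powr p < 2 * \<bar>x $ i\<bar> powr p"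
    if "h $ i \<noteq> 0" for i
    using abs_powr_midpoint_strict assms(1,2) that small[OF that] by blast
  have "(\<Sum>i\<in>UNIV. \<bar>x $ i + h $ i\<bar> powr p + \<bar>x $ i - h $ i\<bar> powr p)
      < (\<Sum>i\<in>UNIV. 2 * \<bar>x $ i\<bar> powr p)"
  proof (rule sum_strict_mono_ex1)
    show "\<forall>i\<in>UNIV. \<bar>x $ i + h $ i\<bar> powr p + \<bar>x $ i - h $ i\<bar> powr p \<le> 2 * \<bar>x $ i\<bar> powr p"
    proof
      fix i show "\<bar>x $ i + h $ i\<bar> powr p + \<bar>x $ i - h $ i\<bar> powr p \<le> 2 * \<bar>x $ i\<bar> powr p"
        using strict[of i] by (cases "h $ i = 0") auto
    qed
  qed (use strict k in auto)
  then show ?thesis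
    by (simp add: lp_pow_def sum.distrib sum_distrib_left)
qed

text \<open>The step is too short to change the sign of \<open>r\<close>, so on both sides taking
  absolute values is multiplication by the common sign of \<open>r\<close> and \<open>s\<close>. For
  \<open>r = 0\<close> also \<open>s = 0\<close>.\<close>

lemma abs_line_same_sgn:
  fixes r s t :: real
  assumes "sgn r = sgn s" "r \<noteq> 0 \<Longrightarrow> \<bar>t * (s - r)\<bar> < \<bar>r\<bar>"
  shows "\<bar>r + t * (s - r)\<bar> = \<bar>r\<bar> + t * (\<bar>s\<bar> - \<bar>r\<bar>)"
proof (cases r "0 :: real" rule: linorder_cases)
  case less
  moreover have "s < 0" using assms(1) less by (metis sgn_less)
  ultimately show ?thesis using assms(2) by (auto simp: algebra_simps)
next
  case equal
  then show ?thesis using assms(1) by (auto simp: sgn_0_0)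
next
  case greater
  moreover have "s > 0" using assms(1) greater by (metis sgn_greater)
  ultimately show ?thesis using assms(2) by (auto simp: algebra_simps)
qed

lemma l1_norm_line_same_sgn:
  fixes r s :: "real ^ 'k"
  assumes "sgn_pattern r = sgn_pattern s"
    and "\<And>j. r $ j \<noteq> 0 \<Longrightarrow> \<bar>t * (s $ j - r $ j)\<bar> < \<bar>r $ j\<bar>"
  shows "l1_norm (r + t *\<^sub>R (s - r)) = l1_norm r + t * (l1_norm s - l1_norm r)"
proof -
  have "\<bar>(r + t *\<^sub>R (s - r)) $ j\<bar> = \<bar>r $ j\<bar> + t * (\<bar>s $ j\<bar> - \<bar>r $ j\<bar>)" for j
    using abs_line_same_sgn[of "r $ j" "s $ j" t] assms(2)[of j] fun_cong[OF assms(1), of j]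
    by (simp add: sgn_pattern_def)
  then show ?thesis
    by (simp add: l1_norm_def sum.distrib sum_subtractf flip: sum_distrib_left)
qed

lemma eventually_mult_abs_less:
  fixes c w :: real
  assumes "w > 0"
  shows "eventually (\<lambda>e. e * \<bar>c\<bar> < w) (at_right 0)"
proof -
  have "((\<lambda>e. e * \<bar>c\<bar>) \<longlongrightarrow> 0 * \<bar>c\<bar>) (at_right 0)"
    by (intro tendsto_intros)
  then show ?thesis
    using assms by (auto intro: order_tendstoD(2))
qed

text \<open>Only feasibility is asked of \<open>y\<close>, so \<open>y\<close> may be a minimizer
  for another exponent; this settles the union over all exponents at once.\<close>

lemma SOL1_unique_in_pattern:
  fixes A :: "real ^ 'n ^ 'm" and x y :: "real ^ 'n"
  assumes p: "0 < p" "p < 1"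
    and x: "x \<in> SOL1 A b \<sigma> p" and y: "y \<in> feasible_set A b \<sigma>"
    and sx: "sgn_pattern x = sgn_pattern y"
    and sr: "sgn_pattern (A *v x - b) = sgn_pattern (A *v y - b)"
    and active: "l1_norm (A *v x - b) = \<sigma> \<longleftrightarrow> l1_norm (A *v y - b) = \<sigma>"
  shows "x = y"
proof (rule ccontr)
  assume "x \<noteq> y"
  define r s where "r = A *v x - b" and "s = A *v y - b"
  have le: "l1_norm r \<le> \<sigma>" "l1_norm s \<le> \<sigma>"
    using x y by (auto simp: SOL1_def feasible_set_def r_def s_def)
  \<comment> \<open>The step size \<open>e\<close> must preserve the signs of the nonzero entries of
    \<open>x\<close> and of the residual \<open>r\<close>, and must not use up the slack of an
    inactive constraint.\<close>
  have "eventually (\<lambda>e. \<forall>i. x $ i \<noteq> 0 \<longrightarrow> e * \<bar>y $ i - x $ i\<bar> < \<bar>x $ i\<bar>) (at_right 0)"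
    by (intro eventually_all_finite) (auto intro: eventually_mult_abs_less)
  moreover have "eventually (\<lambda>e. \<forall>j. r $ j \<noteq> 0 \<longrightarrow> e * \<bar>s $ j - r $ j\<bar> < \<bar>r $ j\<bar>) (at_right 0)"
    by (intro eventually_all_finite) (auto intro: eventually_mult_abs_less)
  moreover have "eventually
      (\<lambda>e. l1_norm r < \<sigma> \<longrightarrow> e * \<bar>l1_norm s - l1_norm r\<bar> < \<sigma> - l1_norm r) (at_right 0)"
    by (cases "l1_norm r < \<sigma>") (auto intro: eventually_mult_abs_less)
  moreover have "eventually (\<lambda>e::real. e > 0) (at_right 0)"
    by (rule eventually_at_right_less)
  ultimately have "eventually (\<lambda>e. e > 0 \<and>
      (\<forall>i. x $ i \<noteq> 0 \<longrightarrow> e * \<bar>y $ i - x $ i\<bar> < \<bar>x $ i\<bar>) \<and>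
      (\<forall>j. r $ j \<noteq> 0 \<longrightarrow> e * \<bar>s $ j - r $ j\<bar> < \<bar>r $ j\<bar>) \<and>
      (l1_norm r < \<sigma> \<longrightarrow> e * \<bar>l1_norm s - l1_norm r\<bar> < \<sigma> - l1_norm r)) (at_right 0)"
    by eventually_elim auto
  then obtain e where e: "e > 0"
      "\<And>i. x $ i \<noteq> 0 \<Longrightarrow> e * \<bar>y $ i - x $ i\<bar> < \<bar>x $ i\<bar>"
      "\<And>j. r $ j \<noteq> 0 \<Longrightarrow> e * \<bar>s $ j - r $ j\<bar> < \<bar>r $ j\<bar>"
      "l1_norm r < \<sigma> \<Longrightarrow> e * \<bar>l1_norm s - l1_norm r\<bar> < \<sigma> - l1_norm r"
    by (auto dest!: eventually_happens'[OF trivial_limit_at_right_real])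
  have feasible: "x + t *\<^sub>R (y - x) \<in> feasible_set A b \<sigma>" if "\<bar>t\<bar> = e" for t
  proof -
    have "A *v (x + t *\<^sub>R (y - x)) - b = r + t *\<^sub>R (s - r)"
      by (simp add: r_def s_def matrix_vector_right_distrib matrix_vector_mult_scaleR
          matrix_vector_mult_diff_distrib)
    moreover have "l1_norm (r + t *\<^sub>R (s - r)) = l1_norm r + t * (l1_norm s - l1_norm r)"
      using l1_norm_line_same_sgn[of r s t] sr e(3) that by (simp add: r_def s_def abs_mult)
    moreover have "l1_norm r + t * (l1_norm s - l1_norm r) \<le> \<sigma>"
    \<comment> \<open>If the constraint is active at \<open>x\<close>, it is active at
      \<open>y\<close> too, and the affine function is constant. This is why the pattern records
      activity: otherwise the norm could grow in the direction away from \<open>y\<close>. If it is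
      inactive, the slack absorbs the change.\<close>
    proof (cases "l1_norm r = \<sigma>")
      case True
      then show ?thesis using active by (simp add: r_def s_def)
    next
      case False
      have "t * (l1_norm s - l1_norm r) \<le> e * \<bar>l1_norm s - l1_norm r\<bar>"
        using abs_ge_self[of "t * (l1_norm s - l1_norm r)"] that by (simp add: abs_mult)
      then show ?thesis using e(4) le False by linarith
    qed
    ultimately show ?thesis by (simp add: feasible_set_def)
  qed
  define h where "h = e *\<^sub>R (y - x)"
  have "x + h \<in> feasible_set A b \<sigma>" "x - h \<in> feasible_set A b \<sigma>"
    using feasible[of e] feasible[of "- e"] e(1) by (auto simp: h_def)
  then have "lp_pow p x \<le> lp_pow p (x + h)" "lp_pow p x \<le> lp_pow p (x - h)"
    using x by (auto simp: SOL1_def)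
  moreover have "lp_pow p (x + h) + lp_pow p (x - h) < 2 * lp_pow p x"
  proof (rule lp_pow_midpoint_strict[OF p])
    show "h \<noteq> 0" using \<open>x \<noteq> y\<close> e(1) by (simp add: h_def)
    fix i assume "h $ i \<noteq> 0"
    \<comment> \<open>A zero entry of \<open>x\<close> is also zero in \<open>y\<close>, so
      \<open>h\<close> vanishes there.\<close>
    moreover have "sgn (x $ i) = sgn (y $ i)"
      using fun_cong[OF sx, of i] by (simp add: sgn_pattern_def)
    ultimately have "x $ i \<noteq> 0"
      by (auto simp: h_def sgn_0_0)
    then show "\<bar>h $ i\<bar> < \<bar>x $ i\<bar>"
      using e(1) e(2)[of i] by (simp add: h_def abs_mult)
  qed
  ultimately show False by linarith
qed

theorem proposition2p1:
  fixes A :: "real ^ 'n ^ 'm" and b :: "real ^ 'm" and \<sigma> :: real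
  assumes "\<sigma> \<ge> 0"
    and "feasible_set A b \<sigma> \<noteq> {}"
    and "l1_norm b > \<sigma>"
  shows "(\<forall>p::real. 0 < p \<and> p < 1 \<longrightarrow> finite (SOL1 A b \<sigma> p)) \<and>
         finite (\<Union>p\<in>{0<..<1}. SOL1 A b \<sigma> p)"
proof -
  define S where "S = (\<Union>p\<in>{0<..<1}. SOL1 A b \<sigma> p)"
  define pat where "pat x = (sgn_pattern x, sgn_pattern (A *v x - b), l1_norm (A *v x - b) = \<sigma>)"
    for x
  have "inj_on pat S"
  proof (rule inj_onI)
    fix x y assume "x \<in> S" "y \<in> S" "pat x = pat y"
    then show "x = y"
      using SOL1_unique_in_pattern[of _ x A b \<sigma> y] by (auto simp: S_def pat_def SOL1_def)
  qed
  moreover have "finite (pat ` S)"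
  proof (rule finite_subset)
    show "pat ` S \<subseteq> range sgn_pattern \<times> range sgn_pattern \<times> UNIV"
      by (auto simp: pat_def)
  qed (simp add: finite_range_sgn_pattern)
  ultimately have "finite S"
    by (simp add: finite_image_iff)
  \<comment> \<open>The claim for a single exponent follows from the one for the union.\<close>
  moreover have "SOL1 A b \<sigma> p \<subseteq> S" if "0 < p" "p < 1" for p
    using that by (auto simp: S_def)
  ultimately show ?thesis
    unfolding S_def by (meson finite_subset)
qed

end
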